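(* Let $h_6$ be a non-zero homogeneous harmonic polynomial of degree $6$ in $(x,y)$. 1) Let $\rho_7$ be a homogeneous $3$-harmonic polynomial of degree $7$ in $(x,y)$. Then $h_6 + \rho_7$ is $\mathcal{R}_7$-equivalent to $h_6$. 2) Let $\rho_8$ be a homogeneous $4$-harmonic polynomial of degree $8$ in $(x,y)$. Then $h_6 + \rho_8$ is $\mathcal{R}_8$-equivalent to $h_6$.
   Context: $\mathbf{R}^2$ has coordinates $(x,y)$ and $\Delta = \frac{\partial^2}{\partial x^2} + \frac{\partial^2}{\partial y^2}$ is the Laplacian. A function $h$ is harmonic if $\Delta h = 0$, and $l$-harmonic if $\Delta^l h = 0$. Functions are regarded as $C^\infty$ germs $(\mathbf{R}^2,\mathbf{0}) \to (\mathbf{R},0)$. Two germs $h_1,h_2$ are right-equivalent if there is a $C^\infty$ diffeomorphism-germ $\tau \colon (\mathbf{R}^2,\mathbf{0}) \to (\mathbf{R}^2,\mathbf{0})$ with $h_1 \circ \tau = h_2$. The $k$-jet $j^k h(\mathbf{0})$ is the Taylor series of $h$ at the origin up to and including degree $k$. Two germs $h_1, h_2$ are $\mathcal{R}_k$-equivalent if there is a germ $\tilde{h}_2$ with $j^k \tilde{h}_2(\mathbf{0}) = j^k h_2(\mathbf{0})$ such that $h_1$ is right-equivalent to $\tilde{h}_2$. *)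

theory Defs
  imports "HOL-Analysis.Analysis"
begin

text \<open>Germs at the origin are represented by total functions. Harmonicity, jets and the two
  equivalences depend only on the values of such functions near \<open>0\<close>.\<close>

primrec Ck_on :: "nat \<Rightarrow> ('a::euclidean_space \<Rightarrow> 'b::real_normed_vector) \<Rightarrow> 'a set \<Rightarrow> bool" where
  "Ck_on 0 f U \<longleftrightarrow> continuous_on U f"
| "Ck_on (Suc k) f U \<longleftrightarrow> (\<forall>x\<in>U. f differentiable (at x)) \<and>
     (\<forall>v. Ck_on k (\<lambda>x. frechet_derivative f (at x) v) U)"

definition smooth_on :: "('a::euclidean_space \<Rightarrow> 'b::real_normed_vector) \<Rightarrow> 'a set \<Rightarrow> bool" where
  "smooth_on f U \<longleftrightarrow> (\<forall>k. Ck_on k f U)"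

definition smooth_germ :: "('a::euclidean_space \<Rightarrow> 'b::real_normed_vector) \<Rightarrow> bool" where
  "smooth_germ f \<longleftrightarrow> f 0 = 0 \<and> (\<exists>U. open U \<and> 0 \<in> U \<and> smooth_on f U)"

definition diffeo_germ :: "('a::euclidean_space \<Rightarrow> 'a) \<Rightarrow> bool" where
  "diffeo_germ \<tau> \<longleftrightarrow> smooth_germ \<tau> \<and>
     (\<exists>\<sigma>. smooth_germ \<sigma> \<and> (\<forall>\<^sub>F p in nhds 0. \<sigma> (\<tau> p) = p) \<and> (\<forall>\<^sub>F p in nhds 0. \<tau> (\<sigma> p) = p))"

definition partial_x :: "(real \<times> real \<Rightarrow> real) \<Rightarrow> real \<times> real \<Rightarrow> real" where
  "partial_x f = (\<lambda>p. frechet_derivative f (at p) (1, 0))"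

definition partial_y :: "(real \<times> real \<Rightarrow> real) \<Rightarrow> real \<times> real \<Rightarrow> real" where
  "partial_y f = (\<lambda>p. frechet_derivative f (at p) (0, 1))"

definition laplacian :: "(real \<times> real \<Rightarrow> real) \<Rightarrow> real \<times> real \<Rightarrow> real" where
  "laplacian f = (\<lambda>p. partial_x (partial_x f) p + partial_y (partial_y f) p)"

text \<open>The next two predicates are meant for smooth germs only: \<open>frechet_derivative\<close> is unspecified
  where the function is not differentiable.\<close>

definition harmonic :: "(real \<times> real \<Rightarrow> real) \<Rightarrow> bool" where
  "harmonic h \<longleftrightarrow> (\<forall>\<^sub>F p in nhds 0. laplacian h p = 0)"

definition l_harmonic :: "nat \<Rightarrow> (real \<times> real \<Rightarrow> real) \<Rightarrow> bool" where
  "l_harmonic l h \<longleftrightarrow> (\<forall>\<^sub>F p in nhds 0. (laplacian ^^ l) h p = 0)"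

text \<open>The zero polynomial counts as homogeneous of every degree.\<close>

definition homogeneous_poly :: "nat \<Rightarrow> (real \<times> real \<Rightarrow> real) \<Rightarrow> bool" where
  "homogeneous_poly d h \<longleftrightarrow>
     (\<exists>c :: nat \<Rightarrow> real. h = (\<lambda>(x, y). \<Sum>i\<le>d. c i * x ^ i * y ^ (d - i)))"

text \<open>The \<open>k\<close>-jet is the Taylor polynomial at the origin, viewed as a polynomial function.\<close>

definition jet :: "nat \<Rightarrow> (real \<times> real \<Rightarrow> real) \<Rightarrow> real \<times> real \<Rightarrow> real" where
  "jet k h = (\<lambda>(x, y). \<Sum>d\<le>k. \<Sum>i\<le>d.
     (partial_x ^^ i) ((partial_y ^^ (d - i)) h) 0 / (fact i * fact (d - i)) * x ^ i * y ^ (d - i))"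

definition right_equivalent :: "(real \<times> real \<Rightarrow> real) \<Rightarrow> (real \<times> real \<Rightarrow> real) \<Rightarrow> bool" where
  "right_equivalent h1 h2 \<longleftrightarrow> (\<exists>\<tau>. diffeo_germ \<tau> \<and> (\<forall>\<^sub>F p in nhds 0. h1 (\<tau> p) = h2 p))"

definition Rk_equivalent ::
    "nat \<Rightarrow> (real \<times> real \<Rightarrow> real) \<Rightarrow> (real \<times> real \<Rightarrow> real) \<Rightarrow> bool" where
  "Rk_equivalent k h1 h2 \<longleftrightarrow>
     (\<exists>h2'. smooth_germ h2' \<and> jet k h2' = jet k h2 \<and> right_equivalent h1 h2')"

end

theory Submission
  imports Defs
begin

text \<open>Write \<open>z = x + i y\<close>. Then \<open>h6 = Re (a z^6)\<close> with \<open>a \<noteq> 0\<close>, and the hypothesis on the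
  perturbation of degree \<open>6 + m\<close>, \<open>m = 1, 2\<close>, says exactly that all its monomials in \<open>z\<close> and its
  conjugate are divisible by \<open>z^5\<close> or by the conjugate of \<open>z^5\<close>, that is, it equals \<open>Re (z^5 W)\<close>
  with \<open>W\<close> homogeneous of degree \<open>m + 1\<close>. The substitution \<open>z \<mapsto> z - W / (6 a)\<close> changes
  \<open>Re (a z^6)\<close> by \<open>- Re (z^5 W)\<close> up to terms of degree at least \<open>7 + m\<close>, so it removes the
  perturbation from the \<open>(6 + m)\<close>-jet.\<close>

subsection \<open>Polynomial functions of prescribed order and their jets\<close>

text \<open>The \<open>n\<close>-th power of the ideal of the origin in the polynomial ring, taken
  as functions. The index is only a lower bound on the order, so zero belongs to every level, and
  closure properties become inductions over monomials.\<close>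

inductive vanishing_poly :: "nat \<Rightarrow> (real \<times> real \<Rightarrow> real) \<Rightarrow> bool" for n where
  monom: "n \<le> i + j \<Longrightarrow> vanishing_poly n (\<lambda>p. c * fst p ^ i * snd p ^ j)"
| add: "vanishing_poly n f \<Longrightarrow> vanishing_poly n g \<Longrightarrow> vanishing_poly n (\<lambda>p. f p + g p)"

lemma vanishing_poly_mono:
  assumes "vanishing_poly n f" "m \<le> n"
  shows "vanishing_poly m f"
  using assms by induction (auto intro: vanishing_poly.intros)

lemma vanishing_poly_const: "vanishing_poly 0 (\<lambda>p. c)"
  using vanishing_poly.monom[of 0 0 0 c] by simp

lemma vanishing_poly_zero: "vanishing_poly n (\<lambda>p. 0)"
  using vanishing_poly.monom[of n n 0 0] by simp

lemma vanishing_poly_fst: "vanishing_poly 1 fst"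
  using vanishing_poly.monom[of 1 1 0 1] by simp

lemma vanishing_poly_snd: "vanishing_poly 1 snd"
  using vanishing_poly.monom[of 1 0 1 1] by simp

lemma vanishing_poly_mult:
  assumes "vanishing_poly m f" "vanishing_poly n g"
  shows "vanishing_poly (m + n) (\<lambda>p. f p * g p)"
  using assms(1)
proof induction
  case (monom i j c)
  from assms(2) show ?case
  proof induction
    case (monom i' j' c')
    have "(\<lambda>p. c * fst p ^ i * snd p ^ j * (c' * fst p ^ i' * snd p ^ j'))
        = (\<lambda>p :: real \<times> real. (c * c') * fst p ^ (i + i') * snd p ^ (j + j'))"
      by (auto simp: power_add algebra_simps)
    then show ?case
      using vanishing_poly.monom[of "m + n" "i + i'" "j + j'" "c * c'"] monom \<open>m \<le> i + j\<close> by simp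
  next
    case (add f g)
    then show ?case by (simp add: distrib_left vanishing_poly.add)
  qed
next
  case (add f g)
  then show ?case by (simp add: distrib_right vanishing_poly.add)
qed

lemma vanishing_poly_cmult:
  assumes "vanishing_poly n f"
  shows "vanishing_poly n (\<lambda>p. c * f p)"
  using vanishing_poly_mult[OF vanishing_poly_const assms] by simp

lemma vanishing_poly_minus:
  assumes "vanishing_poly n f"
  shows "vanishing_poly n (\<lambda>p. - f p)"
  using vanishing_poly_cmult[OF assms, of "-1"] by simp

lemma vanishing_poly_diff:
  assumes "vanishing_poly n f" "vanishing_poly n g"
  shows "vanishing_poly n (\<lambda>p. f p - g p)"
  using vanishing_poly.add[OF assms(1) vanishing_poly_minus[OF assms(2)]] by simp

lemma vanishing_poly_sum:
  assumes "\<And>i. i \<in> A \<Longrightarrow> vanishing_poly n (f i)"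
  shows "vanishing_poly n (\<lambda>p. \<Sum>i\<in>A. f i p)"
  using assms
proof (induction A rule: infinite_finite_induct)
  case (insert i A)
  then show ?case by (simp add: vanishing_poly.add)
qed (simp_all add: vanishing_poly_zero)

lemma vanishing_poly_power:
  assumes "vanishing_poly n f"
  shows "vanishing_poly (n * k) (\<lambda>p. f p ^ k)"
proof (induction k)
  case 0
  show ?case by (simp add: vanishing_poly_const)
next
  case (Suc k)
  show ?case using vanishing_poly_mult[OF assms Suc] by simp
qed

lemma vanishing_poly_at_0:
  assumes "vanishing_poly n f" "0 < n"
  shows "f 0 = 0"
  using assms by induction (auto simp: power_0_left)

text \<open>Differentiation costs at most one order. The total derivative is produced together with
  both partials because \<open>partial_x\<close> and \<open>partial_y\<close> are read off from
  \<open>frechet_derivative\<close>, which is meaningful only once differentiability is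
  known.\<close>

lemma vanishing_poly_has_derivative:
  assumes "vanishing_poly n f"
  obtains f1 f2 where "vanishing_poly (n - 1) f1" "vanishing_poly (n - 1) f2"
    "\<And>p. (f has_derivative (\<lambda>v. fst v * f1 p + snd v * f2 p)) (at p)"
  using assms
proof (induction arbitrary: thesis)
  case (monom i j c)
  \<comment> \<open>For \<open>i = 0\<close> the exponent \<open>i - 1\<close> is truncated to 0,
    but the coefficient \<open>c * i\<close> vanishes; likewise for \<open>j\<close> below.\<close>
  let ?f1 = "\<lambda>p :: real \<times> real. (c * i) * fst p ^ (i - 1) * snd p ^ j"
  let ?f2 = "\<lambda>p :: real \<times> real. (c * j) * fst p ^ i * snd p ^ (j - 1)"
  show ?case
  proof (rule monom(2)[of ?f1 ?f2])
    show "vanishing_poly (n - 1) ?f1" "vanishing_poly (n - 1) ?f2"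
      using monom(1) by (auto intro!: vanishing_poly.monom simp del: of_nat_diff)
    show "((\<lambda>p. c * fst p ^ i * snd p ^ j) has_derivative (\<lambda>v. fst v * ?f1 p + snd v * ?f2 p)) (at p)"
      for p
      by (rule derivative_eq_intros refl | simp add: fun_eq_iff algebra_simps)+
  qed
next
  case (add f g)
  obtain f1 f2 where f: "vanishing_poly (n - 1) f1" "vanishing_poly (n - 1) f2"
    "\<And>p. (f has_derivative (\<lambda>v. fst v * f1 p + snd v * f2 p)) (at p)"
    by (rule add.IH(1)) (rule that)
  obtain g1 g2 where g: "vanishing_poly (n - 1) g1" "vanishing_poly (n - 1) g2"
    "\<And>p. (g has_derivative (\<lambda>v. fst v * g1 p + snd v * g2 p)) (at p)"
    by (rule add.IH(2)) (rule that)
  show ?case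
  proof (rule add.prems)
    show "vanishing_poly (n - 1) (\<lambda>p. f1 p + g1 p)" "vanishing_poly (n - 1) (\<lambda>p. f2 p + g2 p)"
      using f g by (auto intro: vanishing_poly.add)
    show "((\<lambda>p. f p + g p) has_derivative (\<lambda>v. fst v * (f1 p + g1 p) + snd v * (f2 p + g2 p))) (at p)"
      for p
      using has_derivative_add[OF f(3)[of p] g(3)[of p]] by (simp add: algebra_simps)
  qed
qed

section \<open>Iterated partial derivatives and Taylor coefficients of polynomial functions\<close>

lemma partial_x_eq:
  assumes "\<And>p. (f has_derivative (\<lambda>v. fst v * f1 p + snd v * f2 p)) (at p)"
  shows "partial_x f = f1"
  unfolding partial_x_def frechet_derivative_at[OF assms, symmetric] by simp

lemma partial_y_eq:
  assumes "\<And>p. (f has_derivative (\<lambda>v. fst v * f1 p + snd v * f2 p)) (at p)"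
  shows "partial_y f = f2"
  unfolding partial_y_def frechet_derivative_at[OF assms, symmetric] by simp

lemma vanishing_poly_partial:
  assumes "vanishing_poly n f"
  shows "vanishing_poly (n - 1) (partial_x f)" "vanishing_poly (n - 1) (partial_y f)"
    and "(f has_derivative (\<lambda>v. fst v * partial_x f p + snd v * partial_y f p)) (at p)"
proof -
  obtain f1 f2 where f: "vanishing_poly (n - 1) f1" "vanishing_poly (n - 1) f2"
    "\<And>p. (f has_derivative (\<lambda>v. fst v * f1 p + snd v * f2 p)) (at p)"
    using vanishing_poly_has_derivative[OF assms] by metis
  then show "vanishing_poly (n - 1) (partial_x f)" "vanishing_poly (n - 1) (partial_y f)"
    and "(f has_derivative (\<lambda>v. fst v * partial_x f p + snd v * partial_y f p)) (at p)"
    by (simp_all add: partial_x_eq[OF f(3)] partial_y_eq[OF f(3)])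
qed

lemma partial_add:
  assumes f: "vanishing_poly m f" and g: "vanishing_poly n g"
  shows "partial_x (\<lambda>p. f p + g p) = (\<lambda>p. partial_x f p + partial_x g p)"
    and "partial_y (\<lambda>p. f p + g p) = (\<lambda>p. partial_y f p + partial_y g p)"
proof -
  have "((\<lambda>p. f p + g p) has_derivative (\<lambda>v. fst v * (partial_x f p + partial_x g p)
      + snd v * (partial_y f p + partial_y g p))) (at p)" for p
    using has_derivative_add[OF vanishing_poly_partial(3)[OF f] vanishing_poly_partial(3)[OF g]]
    by (simp add: algebra_simps)
  then show "partial_x (\<lambda>p. f p + g p) = (\<lambda>p. partial_x f p + partial_x g p)"
    and "partial_y (\<lambda>p. f p + g p) = (\<lambda>p. partial_y f p + partial_y g p)"
    by (rule partial_x_eq partial_y_eq)+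
qed

lemma vanishing_poly_partial_iter:
  assumes "vanishing_poly n f"
  shows "vanishing_poly (n - k) ((partial_x ^^ k) f)" "vanishing_poly (n - k) ((partial_y ^^ k) f)"
proof (induction k)
  case (Suc k)
  {
    case 1
    show ?case using vanishing_poly_partial(1)[OF Suc(1)] by simp
  next
    case 2
    show ?case using vanishing_poly_partial(2)[OF Suc(2)] by simp
  }
qed (use assms in simp_all)

lemma partial_iter_add:
  assumes "vanishing_poly m f" "vanishing_poly n g"
  shows "(partial_x ^^ k) (\<lambda>p. f p + g p) = (\<lambda>p. (partial_x ^^ k) f p + (partial_x ^^ k) g p)"
    and "(partial_y ^^ k) (\<lambda>p. f p + g p) = (\<lambda>p. (partial_y ^^ k) f p + (partial_y ^^ k) g p)"
  by (induction k)
    (simp_all add: partial_add[OF vanishing_poly_partial_iter(1)[OF assms(1)] vanishing_poly_partial_iter(1)[OF assms(2)]]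
      partial_add[OF vanishing_poly_partial_iter(2)[OF assms(1)] vanishing_poly_partial_iter(2)[OF assms(2)]])

text \<open>A Taylor coefficient of degree at most \<open>k\<close> uses at most \<open>k\<close>
  derivatives, which leave \<open>g\<close> with order at least 1 and hence with value 0 at the
  origin. The order of \<open>f\<close> is arbitrary: \<open>f\<close> only has to be polynomial for
  the partials to be additive.\<close>

lemma jet_add_vanishing:
  assumes f: "vanishing_poly m f" and g: "vanishing_poly (Suc k) g"
  shows "jet k (\<lambda>p. f p + g p) = jet k f"
proof -
  have "(partial_x ^^ i) ((partial_y ^^ (d - i)) (\<lambda>p. f p + g p)) 0
      = (partial_x ^^ i) ((partial_y ^^ (d - i)) f) 0" if "d \<le> k" "i \<le> d" for d i
  proof -
    note fy = vanishing_poly_partial_iter(2)[OF f, of "d - i"]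
      and gy = vanishing_poly_partial_iter(2)[OF g, of "d - i"]
    have "(partial_x ^^ i) ((partial_y ^^ (d - i)) g) 0 = 0"
      using that by (intro vanishing_poly_at_0[OF vanishing_poly_partial_iter(1)[OF gy]]) simp
    then show ?thesis
      by (simp add: partial_iter_add(2)[OF f g] partial_iter_add(1)[OF fy gy])
  qed
  then show ?thesis
    unfolding jet_def by (intro ext) (auto intro!: sum.cong)
qed

text \<open>Binomially, every term of \<open>f(p + q(p)) - f(p)\<close> contains a factor \<open>q\<close>, of order 2, in place of
  a coordinate, of order 1.\<close>

lemma vanishing_poly_shift:
  assumes f: "vanishing_poly n f" and q: "vanishing_poly 2 q1" "vanishing_poly 2 q2"
  shows "vanishing_poly (Suc n) (\<lambda>p. f (fst p + q1 p, snd p + q2 p) - f p)"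
proof -
  have shift_power: "vanishing_poly (Suc i) (\<lambda>p. (x p + q p) ^ i - x p ^ i)"
    if x: "vanishing_poly 1 x" and q: "vanishing_poly 2 q" for x q :: "real \<times> real \<Rightarrow> real" and i
  proof (induction i)
    case 0
    show ?case by (simp add: vanishing_poly_zero)
  next
    case (Suc i)
    \<comment> \<open>Telescoping: the first summand has order \<open>1 + Suc i\<close>, the second
      \<open>2 + i\<close>, both equal to \<open>Suc (Suc i)\<close>.\<close>
    have *: "(\<lambda>p. (x p + q p) ^ Suc i - x p ^ Suc i)
        = (\<lambda>p. (x p + q p) * ((x p + q p) ^ i - x p ^ i) + q p * x p ^ i)"
      by (simp add: fun_eq_iff algebra_simps)
    have "vanishing_poly 1 (\<lambda>p. x p + q p)"
      using x vanishing_poly_mono[OF q, of 1] by (auto intro: vanishing_poly.add)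
    from vanishing_poly_mult[OF this Suc] vanishing_poly_mult[OF q vanishing_poly_power[OF x, of i]]
    show ?case unfolding * by (auto intro: vanishing_poly.add)
  qed
  from f show ?thesis
  proof induction
    case (monom i j c)
    note fst = vanishing_poly_fst and snd = vanishing_poly_snd
    \<comment> \<open>The two coordinates are shifted one after the other, so each summand contains
      exactly one difference of powers.\<close>
    have *: "(\<lambda>p. c * fst (fst p + q1 p, snd p + q2 p) ^ i * snd (fst p + q1 p, snd p + q2 p) ^ j
          - c * fst p ^ i * snd p ^ j)
        = (\<lambda>p. c * (((fst p + q1 p) ^ i - fst p ^ i) * (snd p + q2 p) ^ j
          + fst p ^ i * ((snd p + q2 p) ^ j - snd p ^ j)))"
      by (simp add: fun_eq_iff algebra_simps)
    have "vanishing_poly 1 (\<lambda>p. snd p + q2 p)"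
      using snd vanishing_poly_mono[OF q(2), of 1] by (auto intro: vanishing_poly.add)
    from vanishing_poly_mult[OF shift_power[OF fst q(1), of i] vanishing_poly_power[OF this, of j]]
      vanishing_poly_mult[OF vanishing_poly_power[OF fst, of i] shift_power[OF snd q(2), of j]]
    have "vanishing_poly (Suc (i + j)) (\<lambda>p. ((fst p + q1 p) ^ i - fst p ^ i) * (snd p + q2 p) ^ j
          + fst p ^ i * ((snd p + q2 p) ^ j - snd p ^ j))"
      by (auto intro: vanishing_poly.add)
    then show ?case
      unfolding * using monom by (auto intro: vanishing_poly_cmult vanishing_poly_mono)
  next
    case (add f g)
    from vanishing_poly.add[OF add.IH] show ?case by (simp add: algebra_simps)
  qed
qed

subsection \<open>Smoothness and local inverses\<close>

lemma Ck_on_Suc_has_derivative: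
  assumes "Ck_on (Suc k) f U" "x \<in> U"
  shows "(f has_derivative frechet_derivative f (at x)) (at x)"
proof -
  have "f differentiable (at x)" using assms by simp
  then show ?thesis by (rule frechet_derivative_works[THEN iffD1])
qed

text \<open>On an open set the derivative at a point depends only on values inside the set, so
  formulas valid merely on \<open>U\<close> can be substituted at every level of the
  recursion.\<close>

lemma Ck_on_cong:
  assumes "Ck_on k f U" "open U" "\<And>x. x \<in> U \<Longrightarrow> f x = g x"
  shows "Ck_on k g U"
  using assms(1,3)
proof (induction k arbitrary: f g)
  case 0
  then show ?case using continuous_on_cong[of U U f g] by simp
next
  case (Suc k)
  have der: "(g has_derivative frechet_derivative f (at x)) (at x)" if "x \<in> U" for x
  proof (rule has_derivative_transform_within_open)
    show "(f has_derivative frechet_derivative f (at x)) (at x)"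
      by (rule Ck_on_Suc_has_derivative[OF Suc.prems(1) that])
  qed (use assms(2) that Suc.prems(2) in auto)
  have "Ck_on k (\<lambda>x. frechet_derivative g (at x) v) U" for v
  proof (rule Suc.IH)
    show "Ck_on k (\<lambda>x. frechet_derivative f (at x) v) U"
      using Suc.prems(1) by simp
    show "frechet_derivative f (at x) v = frechet_derivative g (at x) v" if "x \<in> U" for x
      by (simp only: frechet_derivative_at[OF der[OF that]])
  qed
  then show ?case using der[THEN differentiableI] by simp
qed

text \<open>Uniqueness of the derivative lets an explicit \<open>f'\<close> stand in for
  \<open>frechet_derivative\<close>; the closure rules below all go through this form.\<close>

lemma Ck_on_SucI:
  assumes "open U" "\<And>x. x \<in> U \<Longrightarrow> (f has_derivative f' x) (at x)"
    and "\<And>v. Ck_on k (\<lambda>x. f' x v) U"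
  shows "Ck_on (Suc k) f U"
proof -
  have "Ck_on k (\<lambda>x. frechet_derivative f (at x) v) U" for v
    by (rule Ck_on_cong[OF assms(3)[of v] assms(1)])
      (simp add: frechet_derivative_at[OF assms(2), symmetric])
  then show ?thesis using assms(2)[THEN differentiableI] by simp
qed

lemma Ck_on_SucD: "Ck_on (Suc k) f U \<Longrightarrow> Ck_on k f U"
proof (induction k arbitrary: f)
  case 0
  then have "f differentiable_on U"
    by (auto simp: differentiable_on_def intro: differentiable_at_withinI)
  then show ?case
    by (simp add: differentiable_imp_continuous_on)
next
  case (Suc k)
  have "Ck_on k (\<lambda>x. frechet_derivative f (at x) v) U" for v
    \<comment> \<open>Only one level of the recursion is unfolded, so that the directional
      derivatives keep the form \<open>Ck_on (Suc k)\<close> expected by the induction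
      hypothesis.\<close>
    using Suc.prems by (intro Suc.IH) (subst (asm) Ck_on.simps(2), blast)
  moreover have "\<forall>x\<in>U. f differentiable (at x)"
    using Suc.prems by (subst (asm) Ck_on.simps(2), blast)
  ultimately show ?case by simp
qed

lemma Ck_on_const: "Ck_on k (\<lambda>x. c) U"
  by (induction k arbitrary: c) simp_all

lemma Ck_on_add:
  assumes "Ck_on k f U" "Ck_on k g U" "open U"
  shows "Ck_on k (\<lambda>x. f x + g x) U"
  using assms(1,2)
proof (induction k arbitrary: f g)
  case 0
  then show ?case by (simp add: continuous_on_add)
next
  case (Suc k)
  show ?case
  proof (rule Ck_on_SucI[OF \<open>open U\<close>])
    show "((\<lambda>x. f x + g x) has_derivative
        (\<lambda>v. frechet_derivative f (at x) v + frechet_derivative g (at x) v)) (at x)" if "x \<in> U" for x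
      using Suc.prems that by (intro has_derivative_add Ck_on_Suc_has_derivative)
  qed (use Suc in auto)
qed

lemma Ck_on_mult:
  fixes f g :: "'a::euclidean_space \<Rightarrow> real"
  assumes "Ck_on k f U" "Ck_on k g U" "open U"
  shows "Ck_on k (\<lambda>x. f x * g x) U"
  using assms(1,2)
proof (induction k arbitrary: f g)
  case 0
  then show ?case by (simp add: continuous_on_mult)
next
  case (Suc k)
  show ?case
  proof (rule Ck_on_SucI[OF \<open>open U\<close>])
    show "((\<lambda>x. f x * g x) has_derivative
        (\<lambda>v. f x * frechet_derivative g (at x) v + frechet_derivative f (at x) v * g x)) (at x)"
      if "x \<in> U" for x
      using Suc.prems that by (intro has_derivative_mult Ck_on_Suc_has_derivative)
    show "Ck_on k (\<lambda>x. f x * frechet_derivative g (at x) v + frechet_derivative f (at x) v * g x) U"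
      for v
      using Suc.prems Ck_on_SucD by (intro Ck_on_add Suc.IH \<open>open U\<close>) auto
  qed
qed

text \<open>The derivative of \<open>inverse (f x)\<close> is a product of derivatives of
  \<open>f\<close> and of \<open>inverse (f x)\<close> itself, so regularity \<open>k\<close> of the
  reciprocal yields regularity \<open>Suc k\<close>.\<close>

lemma Ck_on_inverse:
  fixes f :: "'a::euclidean_space \<Rightarrow> real"
  assumes "Ck_on k f U" "open U" "\<And>x. x \<in> U \<Longrightarrow> f x \<noteq> 0"
  shows "Ck_on k (\<lambda>x. inverse (f x)) U"
  using assms(1)
proof (induction k)
  case 0
  then show ?case using assms(3) by (simp add: continuous_on_inverse)
next
  case (Suc k)
  show ?case
  proof (rule Ck_on_SucI[OF \<open>open U\<close>])
    show "((\<lambda>x. inverse (f x)) has_derivative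
        (\<lambda>v. - (inverse (f x) * frechet_derivative f (at x) v * inverse (f x)))) (at x)"
      if "x \<in> U" for x
      using Suc.prems that assms(3) by (intro Deriv.has_derivative_inverse Ck_on_Suc_has_derivative)
    have "Ck_on k (\<lambda>x. - 1 * (inverse (f x) * frechet_derivative f (at x) v * inverse (f x))) U" for v
      using Suc Ck_on_SucD by (intro Ck_on_mult Ck_on_const \<open>open U\<close>) auto
    then show "Ck_on k (\<lambda>x. - (inverse (f x) * frechet_derivative f (at x) v * inverse (f x))) U" for v
      by simp
  qed
qed

lemma Ck_on_Pair:
  assumes "Ck_on k f U" "Ck_on k g U" "open U"
  shows "Ck_on k (\<lambda>x. (f x, g x)) U"
  using assms(1,2)
proof (induction k arbitrary: f g)
  case 0
  then show ?case by (simp add: continuous_on_Pair)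
next
  case (Suc k)
  show ?case
  proof (rule Ck_on_SucI[OF \<open>open U\<close>])
    show "((\<lambda>x. (f x, g x)) has_derivative
        (\<lambda>v. (frechet_derivative f (at x) v, frechet_derivative g (at x) v))) (at x)" if "x \<in> U" for x
      using Suc.prems that by (intro has_derivative_Pair Ck_on_Suc_has_derivative)
  qed (use Suc in auto)
qed

lemma Ck_on_power:
  fixes f :: "'a::euclidean_space \<Rightarrow> real"
  assumes "Ck_on k f U" "open U"
  shows "Ck_on k (\<lambda>x. f x ^ n) U"
  by (induction n) (auto intro: Ck_on_const Ck_on_mult assms)

text \<open>A polynomial in the components of \<open>g\<close> is built from them by sums and
  products, so this case of the chain rule follows from the closure rules. It serves for polynomials
  evaluated at the local inverse.\<close>

lemma Ck_on_vanishing_poly_compose: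
  assumes f: "vanishing_poly n f" and "open U"
    and "Ck_on k (\<lambda>y. fst (g y)) U" "Ck_on k (\<lambda>y. snd (g y)) U"
  shows "Ck_on k (\<lambda>y. f (g y)) U"
  using f by induction (use assms in \<open>auto intro!: Ck_on_add Ck_on_mult Ck_on_power Ck_on_const\<close>)

lemma Ck_on_vanishing_poly:
  assumes "vanishing_poly n f"
  shows "Ck_on k f UNIV"
  using assms
proof (induction k arbitrary: f n)
  case 0
  show ?case
    using has_derivative_continuous[OF vanishing_poly_partial(3)[OF 0]]
    by (simp add: continuous_at_imp_continuous_on)
next
  case (Suc k)
  show ?case
  proof (rule Ck_on_SucI)
    show "(f has_derivative (\<lambda>v. fst v * partial_x f p + snd v * partial_y f p)) (at p)" for p
      by (rule vanishing_poly_partial(3)[OF Suc.prems])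
    show "Ck_on k (\<lambda>p. fst v * partial_x f p + snd v * partial_y f p) UNIV" for v
      using vanishing_poly_partial(1,2)[OF Suc.prems]
      by (intro Suc.IH[of "n - 1"] vanishing_poly.add vanishing_poly_cmult)
  qed auto
qed

text \<open>The derivative of the local inverse is rational in the inverse itself by Cramer's rule, which
  bootstraps its regularity.\<close>

lemma diffeo_germ_id_plus_vanishing_poly:
  assumes q1: "vanishing_poly 2 q1" and q2: "vanishing_poly 2 q2"
  shows "diffeo_germ (\<lambda>p. (fst p + q1 p, snd p + q2 p))"
proof -
  define \<tau> where "\<tau> = (\<lambda>p :: real \<times> real. (fst p + q1 p, snd p + q2 p))"
  define D where "D = (\<lambda>p v. (fst v * (1 + partial_x q1 p) + snd v * partial_y q1 p,
      fst v * partial_x q2 p + snd v * (1 + partial_y q2 p)))"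
  note dq1 = vanishing_poly_partial[OF q1] and dq2 = vanishing_poly_partial[OF q2]
  have order1: "vanishing_poly 1 (partial_x q1)" "vanishing_poly 1 (partial_y q1)"
    "vanishing_poly 1 (partial_x q2)" "vanishing_poly 1 (partial_y q2)"
    using dq1(1,2) dq2(1,2) by simp_all
  have \<tau>_der: "(\<tau> has_derivative D p) (at p)" for p
    unfolding \<tau>_def D_def
    by (rule derivative_eq_intros dq1(3) dq2(3) refl | simp add: fun_eq_iff algebra_simps)+
  then have lin: "bounded_linear (D p)" for p
    by (rule has_derivative_bounded_linear)
  \<comment> \<open>\<open>inverse_function_theorem\<close> takes the derivative as a continuous map
    into the space of bounded linear functions.\<close>
  define D' where "D' p = Blinfun (D p)" for p
  have D': "blinfun_apply (D' p) = D p" for p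
    unfolding D'_def by (rule bounded_linear_Blinfun_apply[OF lin])
  \<comment> \<open>The partials of \<open>q1\<close> and \<open>q2\<close> have order 1, so they
    vanish at 0: \<open>\<tau>\<close> is tangent to the identity.\<close>
  have D0: "D 0 = id"
    unfolding D_def using order1 by (auto simp: vanishing_poly_at_0)
  have cont: "continuous_on UNIV f" if "vanishing_poly n f" for n f
    using Ck_on_vanishing_poly[OF that, of 0] by simp
  have D'_der: "(\<tau> has_derivative blinfun_apply (D' p)) (at p)" for p
    using \<tau>_der by (simp add: D')
  have D'_cont: "continuous_on UNIV D'"
    unfolding continuous_on_def
    by (rule continuous_on_blinfun_componentwise[unfolded continuous_on_def])
      (auto simp: D' D_def intro!: continuous_intros order1[THEN cont] simp flip: continuous_on_def)
  have D'0: "id_blinfun o\<^sub>L D' 0 = id_blinfun"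
    by (rule blinfun_eqI) (simp add: D' D0)
  obtain U V \<sigma> \<sigma>' where UV: "open U" "0 \<in> U" "open V" "\<tau> 0 \<in> V" "homeomorphism U V \<tau> \<sigma>"
    and \<sigma>: "\<And>y. y \<in> V \<Longrightarrow> (\<sigma> has_derivative \<sigma>' y) (at y)"
      "\<And>y. y \<in> V \<Longrightarrow> \<sigma>' y = inv (D (\<sigma> y))" "\<And>y. y \<in> V \<Longrightarrow> bij (D (\<sigma> y))"
    by (rule inverse_function_theorem[OF open_UNIV D'_der D'_cont UNIV_I D'0, unfolded D'])
      (rule that; assumption)
  have \<tau>0: "\<tau> 0 = 0"
    using vanishing_poly_at_0[OF q1] vanishing_poly_at_0[OF q2] by (simp add: \<tau>_def zero_prod_def)
  define det where "det p = (1 + partial_x q1 p) * (1 + partial_y q2 p) - partial_y q1 p * partial_x q2 p"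
    for p
  have order0: "vanishing_poly 0 (\<lambda>p. 1 + partial_x q1 p)" "vanishing_poly 0 (partial_y q1)"
    "vanishing_poly 0 (partial_x q2)" "vanishing_poly 0 (\<lambda>p. 1 + partial_y q2 p)"
    using order1 by (auto intro!: vanishing_poly.add vanishing_poly_const intro: vanishing_poly_mono)
  have det_poly: "vanishing_poly 0 det"
    unfolding det_def
    using vanishing_poly_diff[OF vanishing_poly_mult[OF order0(1,4)] vanishing_poly_mult[OF order0(2,3)]]
    by simp
  have det_nz: "det (\<sigma> y) \<noteq> 0" if "y \<in> V" for y
  proof
    assume 0: "det (\<sigma> y) = 0"
    let ?p = "\<sigma> y"
    have inj: "v = 0" if "D ?p v = 0" for v
      using \<sigma>(3)[OF \<open>y \<in> V\<close>] that linear_0[OF bounded_linear.linear[OF lin[of ?p]]]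
      by (metis bij_def injD)
    \<comment> \<open>The columns of the adjugate matrix lie in the kernel when the determinant is
      0. Injectivity makes all their entries vanish, so the Jacobian itself is zero, which
      contradicts injectivity.\<close>
    have "D ?p (1 + partial_y q2 ?p, - partial_x q2 ?p) = 0"
      "D ?p (- partial_y q1 ?p, 1 + partial_x q1 ?p) = 0"
      using 0 by (simp_all add: D_def det_def zero_prod_def algebra_simps)
    from this[THEN inj] have "D ?p (1, 0) = 0"
      by (simp add: D_def zero_prod_def)
    from inj[OF this] show False by (simp add: zero_prod_def)
  qed
  \<comment> \<open>Adjugate over determinant: the solution \<open>w\<close> of
    \<open>D (\<sigma> y) w = v\<close>.\<close>
  let ?E = "\<lambda>v y. (inverse (det (\<sigma> y)) * (fst v * (1 + partial_y q2 (\<sigma> y)) - snd v * partial_y q1 (\<sigma> y)),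
      inverse (det (\<sigma> y)) * (snd v * (1 + partial_x q1 (\<sigma> y)) - fst v * partial_x q2 (\<sigma> y)))"
  have \<sigma>'_eq: "\<sigma>' y v = ?E v y" if "y \<in> V" for y v
  proof -
    have "D (\<sigma> y) (?E v y) = (inverse (det (\<sigma> y)) * det (\<sigma> y) * fst v,
        inverse (det (\<sigma> y)) * det (\<sigma> y) * snd v)"
      unfolding D_def det_def prod.inject fst_conv snd_conv by (intro conjI; algebra)
    then have "D (\<sigma> y) (?E v y) = v"
      using det_nz[OF that] by simp
    then show ?thesis
      unfolding \<sigma>(2)[OF that] using inv_f_eq[OF bij_is_inj[OF \<sigma>(3)[OF that]]] by metis
  qed
  \<comment> \<open>The components are treated separately because products and reciprocals are
    available for real-valued functions. If they are C^k then so is \<open>?E\<close>, hence the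
    derivative of \<open>\<sigma>\<close>, and the components are C^(k+1).\<close>
  have "Ck_on k (\<lambda>y. fst (\<sigma> y)) V \<and> Ck_on k (\<lambda>y. snd (\<sigma> y)) V" for k
  proof (induction k)
    case 0
    have "continuous_on V \<sigma>" using UV(5) by (simp add: homeomorphism_def)
    then show ?case by (auto intro: continuous_intros)
  next
    case (Suc k)
    have comp: "Ck_on k (\<lambda>y. f (\<sigma> y)) V" if "vanishing_poly n f" for n f
      using Suc UV(3) by (intro Ck_on_vanishing_poly_compose[OF that]) auto
    have num: "vanishing_poly 0 (\<lambda>p. fst v * (1 + partial_y q2 p) - snd v * partial_y q1 p)"
      "vanishing_poly 0 (\<lambda>p. snd v * (1 + partial_x q1 p) - fst v * partial_x q2 p)" for v
      by (intro vanishing_poly_diff vanishing_poly_cmult order0)+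
    have E: "Ck_on k (\<lambda>y. fst (?E v y)) V" "Ck_on k (\<lambda>y. snd (?E v y)) V" for v
      unfolding fst_conv snd_conv
      by (intro Ck_on_mult[OF Ck_on_inverse[OF comp[OF det_poly]]] comp[OF num(1)] comp[OF num(2)]
          UV(3) det_nz; assumption)+
    have "Ck_on k (\<lambda>y. fst (\<sigma>' y v)) V" "Ck_on k (\<lambda>y. snd (\<sigma>' y v)) V" for v
      by (rule Ck_on_cong[OF E(1)[of v] UV(3)] Ck_on_cong[OF E(2)[of v] UV(3)], simp only: \<sigma>'_eq)+
    then show ?case
      using Ck_on_SucI[OF UV(3) has_derivative_fst[OF \<sigma>(1)]]
        Ck_on_SucI[OF UV(3) has_derivative_snd[OF \<sigma>(1)]] by blast
  qed
  then have "Ck_on k (\<lambda>y. (fst (\<sigma> y), snd (\<sigma> y))) V" for k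
    using UV(3) by (intro Ck_on_Pair) blast+
  then have "smooth_on \<sigma> V"
    by (simp add: smooth_on_def)
  then have "smooth_germ \<sigma>"
    using UV \<tau>0 unfolding smooth_germ_def homeomorphism_def by force
  moreover have "Ck_on k \<tau> UNIV" for k
    unfolding \<tau>_def using q1 q2 vanishing_poly_fst vanishing_poly_snd
    by (intro Ck_on_Pair Ck_on_vanishing_poly[of 1] vanishing_poly.add) (auto intro: vanishing_poly_mono)
  then have "smooth_germ \<tau>"
    using \<tau>0 unfolding smooth_germ_def smooth_on_def by blast
  moreover have "\<forall>\<^sub>F p in nhds 0. \<sigma> (\<tau> p) = p" "\<forall>\<^sub>F p in nhds 0. \<tau> (\<sigma> p) = p"
    using UV \<tau>0 unfolding eventually_nhds homeomorphism_def by metis+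
  ultimately show ?thesis
    unfolding diffeo_germ_def \<tau>_def by blast
qed

subsection \<open>Polyharmonic homogeneous polynomials\<close>

definition hom_poly :: "nat \<Rightarrow> (nat \<Rightarrow> real) \<Rightarrow> real \<times> real \<Rightarrow> real" where
  "hom_poly d c = (\<lambda>(x, y). \<Sum>i\<le>d. c i * x ^ i * y ^ (d - i))"

lemma hom_poly_altdef: "hom_poly d c = (\<lambda>p. \<Sum>i\<le>d. c i * fst p ^ i * snd p ^ (d - i))"
  by (simp add: hom_poly_def fun_eq_iff)

lemma vanishing_poly_hom_poly: "vanishing_poly d (hom_poly d c)"
  unfolding hom_poly_altdef by (auto intro!: vanishing_poly_sum vanishing_poly.monom)

lemma partial_hom_poly:
  shows "partial_x (hom_poly (Suc d) c) = hom_poly d (\<lambda>i. real (Suc i) * c (Suc i))"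
    and "partial_y (hom_poly (Suc d) c) = hom_poly d (\<lambda>i. real (Suc d - i) * c i)"
proof -
  have "(hom_poly (Suc d) c has_derivative
      (\<lambda>v. fst v * hom_poly d (\<lambda>i. real (Suc i) * c (Suc i)) p
         + snd v * hom_poly d (\<lambda>i. real (Suc d - i) * c i) p)) (at p)" for p
  proof -
    let ?x = "fst p" and ?y = "snd p"
    let ?A = "\<lambda>i. c i * (real i * ?x ^ (i - 1)) * ?y ^ (Suc d - i)"
    let ?B = "\<lambda>i. c i * ?x ^ i * (real (Suc d - i) * ?y ^ (Suc d - i - 1))"
    \<comment> \<open>The surplus term of each sum carries the factor 0: \<open>i = 0\<close> in the
      first, \<open>i = Suc d\<close> in the second.\<close>
    have A: "(\<Sum>i\<le>Suc d. ?A i) = hom_poly d (\<lambda>i. real (Suc i) * c (Suc i)) p"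
      by (subst sum.atMost_Suc_shift) (simp add: hom_poly_def case_prod_beta algebra_simps)
    have B: "(\<Sum>i\<le>Suc d. ?B i) = hom_poly d (\<lambda>i. real (Suc d - i) * c i) p"
      by (simp add: hom_poly_def case_prod_beta, rule sum.cong)
        (auto simp: Suc_diff_le algebra_simps)
    have "((\<lambda>p. c i * fst p ^ i * snd p ^ (Suc d - i)) has_derivative
        (\<lambda>v. fst v * ?A i + snd v * ?B i)) (at p)" for i
      by (rule derivative_eq_intros refl | simp add: fun_eq_iff algebra_simps del: of_nat_diff)+
    then have "((\<lambda>p. \<Sum>i\<le>Suc d. c i * fst p ^ i * snd p ^ (Suc d - i)) has_derivative
        (\<lambda>v. \<Sum>i\<le>Suc d. fst v * ?A i + snd v * ?B i)) (at p)"
      by (rule has_derivative_sum)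
    also have "(\<lambda>p. \<Sum>i\<le>Suc d. c i * fst p ^ i * snd p ^ (Suc d - i)) = hom_poly (Suc d) c"
      by (simp only: hom_poly_altdef)
    also have "(\<lambda>v :: real \<times> real. \<Sum>i\<le>Suc d. fst v * ?A i + snd v * ?B i)
        = (\<lambda>v. fst v * (\<Sum>i\<le>Suc d. ?A i) + snd v * (\<Sum>i\<le>Suc d. ?B i))"
      by (simp only: sum.distrib sum_distrib_left)
    finally show ?thesis unfolding A B .
  qed
  then show "partial_x (hom_poly (Suc d) c) = hom_poly d (\<lambda>i. real (Suc i) * c (Suc i))"
    and "partial_y (hom_poly (Suc d) c) = hom_poly d (\<lambda>i. real (Suc d - i) * c i)"
    by (rule partial_x_eq partial_y_eq)+
qed

text \<open>The index \<open>d\<close> is the degree after the Laplacian has been applied to a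
  polynomial of degree \<open>d + 2\<close>.\<close>

definition laplacian_coeff :: "nat \<Rightarrow> (nat \<Rightarrow> real) \<Rightarrow> nat \<Rightarrow> real" where
  "laplacian_coeff d c i =
     real (i + 2) * real (i + 1) * c (i + 2) + real (d + 2 - i) * real (d + 1 - i) * c i"

lemma laplacian_hom_poly:
  "laplacian (hom_poly (d + 2) c) = hom_poly d (laplacian_coeff d c)"
  unfolding laplacian_def numeral_2_eq_2 add_Suc_right add_0_right partial_hom_poly
  by (auto simp: hom_poly_def laplacian_coeff_def fun_eq_iff algebra_simps Suc_diff_le
      simp flip: sum.distrib intro!: sum.cong)

text \<open>Homogeneity spreads vanishing near 0 along rays: at \<open>(t * x, t)\<close> the value
  is \<open>t ^ d\<close> times a polynomial in \<open>x\<close> with coefficients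
  \<open>c i\<close>, which therefore vanishes for every real \<open>x\<close>.\<close>

lemma hom_poly_eventually_0D:
  assumes "\<forall>\<^sub>F p in nhds 0. hom_poly d c p = 0" "i \<le> d"
  shows "c i = 0"
proof -
  have "(\<Sum>i\<le>d. c i * x ^ i) = 0" for x
  proof -
    have "((\<lambda>t. (t * x, t)) \<longlongrightarrow> (0 * x, 0)) (at_right (0 :: real))"
      by (intro tendsto_intros)
    then have "filterlim (\<lambda>t. (t * x, t)) (nhds 0) (at_right (0 :: real))"
      by (simp add: zero_prod_def)
    then have "\<forall>\<^sub>F t in at_right 0. hom_poly d c (t * x, t) = 0"
      using assms(1) by (rule eventually_compose_filterlim[rotated])
    then have "\<forall>\<^sub>F t in at_right 0. hom_poly d c (t * x, t) = 0 \<and> t > 0"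
      using eventually_at_right_less[of "0 :: real"] by (rule eventually_conj)
    then obtain t where t: "hom_poly d c (t * x, t) = 0" "t > 0"
      using eventually_happens by force
    have "hom_poly d c (t * x, t) = t ^ d * (\<Sum>i\<le>d. c i * x ^ i)"
      unfolding hom_poly_def sum_distrib_left prod.case
      by (rule sum.cong) (simp_all add: power_mult_distrib algebra_simps flip: power_add)
    with t show ?thesis by simp
  qed
  with assms(2) show ?thesis by (auto intro: zero_polynom_imp_zero_coeffs)
qed

lemma homogeneous_polyE:
  assumes "homogeneous_poly d h"
  obtains c where "h = hom_poly d c"
  using assms unfolding homogeneous_poly_def hom_poly_def by blast

section \<open>Normal forms in the complex coordinate\<close>

lemma harmonic_sextic:
  assumes "homogeneous_poly 6 h" "harmonic h"
  obtains a where "h = (\<lambda>p. Re (a * Complex (fst p) (snd p) ^ 6))"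
proof -
  obtain c where h: "h = hom_poly 6 c"
    using assms(1) by (rule homogeneous_polyE)
  have "laplacian h = hom_poly 4 (laplacian_coeff 4 c)"
    using laplacian_hom_poly[of 4] h by simp
  then have 0: "laplacian_coeff 4 c i = 0" if "i \<le> 4" for i
    using assms(2) that unfolding harmonic_def by (intro hom_poly_eventually_0D) simp_all
  \<comment> \<open>The relations link \<open>c i\<close> with \<open>c (i + 2)\<close>, so
    everything is determined by \<open>c 6\<close> and \<open>c 5\<close>. These are the
    coefficients of \<open>x ^ 6\<close> and \<open>x ^ 5 * y\<close>, from which the complex factor
    below is read off.\<close>
  have c: "c 0 = - c 6" "c 1 = c 5" "c 2 = 15 * c 6" "c 3 = - 10 / 3 * c 5" "c 4 = - 15 * c 6"
    using 0[of 0] 0[of 1] 0[of 2] 0[of 3] 0[of 4] by (simp_all add: laplacian_coeff_def del: One_nat_def add_2_eq_Suc')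
  have "h p = Re (Complex (c 6) (- c 5 / 6) * Complex (fst p) (snd p) ^ 6)" for p
    unfolding h hom_poly_altdef
    by (simp add: atMost_nat_numeral atMost_Suc c[unfolded One_nat_def])
      (simp add: eval_nat_numeral field_simps)
  then show ?thesis by (intro that ext)
qed

lemma Re_Complex_power_5_mult:
  "Re (Complex x y ^ 5 * Complex u v)
    = (x ^ 5 - 10 * x ^ 3 * y ^ 2 + 5 * x * y ^ 4) * u - (5 * x ^ 4 * y - 10 * x ^ 2 * y ^ 3 + y ^ 5) * v"
  by (simp add: eval_nat_numeral algebra_simps)

text \<open>The Laplacian is 4 times the product of the derivatives in \<open>z\<close> and its
  conjugate, so its cube kills a monomial of degree 7 exactly when one exponent is at most 2, that
  is, the other is at least 5. The proof works in real coefficients: two conditions on eight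
  coefficients match the six parameters of a quadratic \<open>W = u + i v\<close>.\<close>

lemma triharmonic_septic:
  assumes "homogeneous_poly 7 \<rho>" "l_harmonic 3 \<rho>"
  obtains u v where "vanishing_poly 2 u" "vanishing_poly 2 v"
    and "\<rho> = (\<lambda>p. Re (Complex (fst p) (snd p) ^ 5 * Complex (u p) (v p)))"
proof -
  obtain c where \<rho>: "\<rho> = hom_poly 7 c"
    using assms(1) by (rule homogeneous_polyE)
  let ?c = "laplacian_coeff 1 (laplacian_coeff 3 (laplacian_coeff 5 c))"
  have "(laplacian ^^ 3) \<rho> = laplacian (laplacian (laplacian \<rho>))"
    by (simp add: numeral_3_eq_3)
  also have "\<dots> = hom_poly 1 ?c"
    using laplacian_hom_poly[of 5] laplacian_hom_poly[of 3] laplacian_hom_poly[of 1] \<rho>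
    by (simp del: One_nat_def add_2_eq_Suc')
  finally have "?c 0 = 0" "?c 1 = 0"
    using assms(2) unfolding l_harmonic_def by (simp_all add: hom_poly_eventually_0D[of 1 ?c] del: One_nat_def)
  \<comment> \<open>The two coefficients of the iterated Laplacian, divided by a common nonzero
    factor; even and odd indices separate.\<close>
  then have c: "35 * c 0 + 5 * c 2 + 3 * c 4 + 5 * c 6 = 0"
     "5 * c 1 + 3 * c 3 + 5 * c 5 + 35 * c 7 = 0"
    by (simp_all add: laplacian_coeff_def algebra_simps del: One_nat_def add_2_eq_Suc')
  \<comment> \<open>obtained by solving the linear system \<open>c'\<close> below, which is consistent because of \<open>c\<close>\<close>
  define u0 u1 u2 v0 v1 v2 where uv: "u0 = c 7" "u1 = (5 * c 2 + 50 * c 0 - c 6) / 24"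
    "u2 = (5 * c 1 - c 5 - 10 * c 7) / 24" "v0 = (u1 - c 6) / 5" "v1 = 5 * u2 - c 1" "v2 = - c 0"
  have c': "c 7 = u0" "c 6 = u1 - 5 * v0" "c 5 = u2 - 10 * u0 - 5 * v1"
    "c 4 = - 10 * u1 - 5 * v2 + 10 * v0" "c 3 = - 10 * u2 + 5 * u0 + 10 * v1"
    "c 2 = 5 * u1 + 10 * v2 - v0" "c 1 = 5 * u2 - v1" "c 0 = - v2"
    using c unfolding uv by (simp_all add: field_simps)
  \<comment> \<open>The index in \<open>hom_poly\<close> is the exponent of \<open>x\<close>, so the
    lists run from the pure power of \<open>y\<close> upwards.\<close>
  let ?u = "hom_poly 2 (\<lambda>i. [u2, u1, u0] ! i)" and ?v = "hom_poly 2 (\<lambda>i. [v2, v1, v0] ! i)"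
  show ?thesis
  proof (rule that)
    show "\<rho> = (\<lambda>p. Re (Complex (fst p) (snd p) ^ 5 * Complex (?u p) (?v p)))"
      unfolding \<rho> hom_poly_altdef Re_Complex_power_5_mult
      by (simp add: fun_eq_iff atMost_nat_numeral atMost_Suc c'[unfolded One_nat_def])
        (simp add: eval_nat_numeral algebra_simps)
  qed (rule vanishing_poly_hom_poly)+
qed

text \<open>In degree 8 the fourth power of the Laplacian kills the monomials with one exponent at
  most 3, so again the other is at least 5. One condition on nine coefficients matches the eight
  parameters of a cubic \<open>W\<close>.\<close>

lemma tetraharmonic_octic:
  assumes "homogeneous_poly 8 \<rho>" "l_harmonic 4 \<rho>"
  obtains u v where "vanishing_poly 3 u" "vanishing_poly 3 v"
    and "\<rho> = (\<lambda>p. Re (Complex (fst p) (snd p) ^ 5 * Complex (u p) (v p)))"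
proof -
  obtain c where \<rho>: "\<rho> = hom_poly 8 c"
    using assms(1) by (rule homogeneous_polyE)
  let ?c = "laplacian_coeff 0 (laplacian_coeff 2 (laplacian_coeff 4 (laplacian_coeff 6 c)))"
  have "(laplacian ^^ 4) \<rho> = laplacian (laplacian (laplacian (laplacian \<rho>)))"
    by (simp add: eval_nat_numeral)
  also have "\<dots> = hom_poly 0 ?c"
    using laplacian_hom_poly[of 6] laplacian_hom_poly[of 4] laplacian_hom_poly[of 2]
      laplacian_hom_poly[of 0] \<rho>
    by (simp del: add_2_eq_Suc')
  finally have "?c 0 = 0"
    using assms(2) unfolding l_harmonic_def by (auto intro!: hom_poly_eventually_0D[of 0 ?c])
  then have c: "35 * c 0 + 5 * c 2 + 3 * c 4 + 5 * c 6 + 35 * c 8 = 0"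
    by (simp add: laplacian_coeff_def algebra_simps del: One_nat_def add_2_eq_Suc')
  \<comment> \<open>Solution of the system \<open>c'\<close> below. The even-indexed equations
    involve \<open>u0\<close>, \<open>u2\<close>, \<open>v1\<close>, \<open>v3\<close> and are
    consistent by \<open>c\<close>. In the odd ones, eliminating \<open>u1\<close> and
    \<open>v2\<close> leaves two equations for \<open>u3\<close> and \<open>v0\<close>, whence the
    denominator 1024 = 40^2 - 24^2.\<close>
  define u0 u3 u2 v0 u1 v1 v2 v3 where uv: "u0 = c 8"
    "u3 = (24 * (c 5 + 10 * c 7 - 5 * c 1) + 40 * (c 3 - 5 * c 7 + 10 * c 1)) / 1024"
    "u2 = (5 * c 2 + 50 * c 0 - c 6 - 10 * c 8) / 24"
    "v0 = (c 3 - 5 * c 7 + 10 * c 1 - 40 * u3) / 24"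
    "u1 = c 7 + 5 * v0" "v1 = 5 * u2 - c 2 - 10 * c 0" "v2 = 5 * u3 - c 1" "v3 = - c 0"
  have c': "c 8 = u0" "c 7 = u1 - 5 * v0" "c 6 = u2 - 10 * u0 - 5 * v1"
    "c 5 = u3 - 10 * u1 - 5 * v2 + 10 * v0" "c 4 = - 10 * u2 + 5 * u0 - 5 * v3 + 10 * v1"
    "c 3 = - 10 * u3 + 5 * u1 + 10 * v2 - v0" "c 2 = 5 * u2 + 10 * v3 - v1" "c 1 = 5 * u3 - v2"
    "c 0 = - v3"
    using c unfolding uv by (simp_all add: field_simps)
  let ?u = "hom_poly 3 (\<lambda>i. [u3, u2, u1, u0] ! i)"
    and ?v = "hom_poly 3 (\<lambda>i. [v3, v2, v1, v0] ! i)"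
  show ?thesis
  proof (rule that)
    show "\<rho> = (\<lambda>p. Re (Complex (fst p) (snd p) ^ 5 * Complex (?u p) (?v p)))"
      unfolding \<rho> hom_poly_altdef Re_Complex_power_5_mult
      by (simp add: fun_eq_iff atMost_nat_numeral atMost_Suc c'[unfolded One_nat_def])
        (simp add: eval_nat_numeral algebra_simps)
  qed (rule vanishing_poly_hom_poly)+
qed

subsection \<open>Removing the perturbation\<close>

lemma smooth_germ_vanishing_poly:
  assumes "vanishing_poly n f" "0 < n"
  shows "smooth_germ f"
  unfolding smooth_germ_def smooth_on_def
  using vanishing_poly_at_0[OF assms] Ck_on_vanishing_poly[OF assms(1)] by blast

section \<open>Order counting for complex-valued polynomial functions, and the substitution\<close>

definition vanishing_cpoly :: "nat \<Rightarrow> (real \<times> real \<Rightarrow> complex) \<Rightarrow> bool" where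
  "vanishing_cpoly n F \<longleftrightarrow> vanishing_poly n (\<lambda>p. Re (F p)) \<and> vanishing_poly n (\<lambda>p. Im (F p))"

lemma vanishing_cpoly_mono: "vanishing_cpoly n F \<Longrightarrow> m \<le> n \<Longrightarrow> vanishing_cpoly m F"
  by (auto simp: vanishing_cpoly_def intro: vanishing_poly_mono)

lemma vanishing_cpoly_const: "vanishing_cpoly 0 (\<lambda>p. c)"
  by (simp add: vanishing_cpoly_def vanishing_poly_const)

lemma vanishing_cpoly_Complex:
  "vanishing_poly n f \<Longrightarrow> vanishing_poly n g \<Longrightarrow> vanishing_cpoly n (\<lambda>p. Complex (f p) (g p))"
  by (simp add: vanishing_cpoly_def)

lemma vanishing_cpoly_add:
  "vanishing_cpoly n F \<Longrightarrow> vanishing_cpoly n G \<Longrightarrow> vanishing_cpoly n (\<lambda>p. F p + G p)"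
  by (simp add: vanishing_cpoly_def vanishing_poly.add)

lemma vanishing_cpoly_mult:
  "vanishing_cpoly m F \<Longrightarrow> vanishing_cpoly n G \<Longrightarrow> vanishing_cpoly (m + n) (\<lambda>p. F p * G p)"
  by (simp add: vanishing_cpoly_def vanishing_poly_mult vanishing_poly.add vanishing_poly_diff)

lemma vanishing_cpoly_cmult:
  "vanishing_cpoly n F \<Longrightarrow> vanishing_cpoly n (\<lambda>p. c * F p)"
  using vanishing_cpoly_mult[OF vanishing_cpoly_const] by simp

lemma vanishing_cpoly_power:
  assumes "vanishing_cpoly n F"
  shows "vanishing_cpoly (n * k) (\<lambda>p. F p ^ k)"
proof (induction k)
  case 0
  show ?case by (simp add: vanishing_cpoly_const)
next
  case (Suc k)
  show ?case using vanishing_cpoly_mult[OF assms Suc] by simp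
qed

text \<open>Two errors remain after the substitution. The part of \<open>a * (Z + Q) ^ 6\<close>
  beyond first order in \<open>Q\<close> has order at least \<open>2 * Suc m + 4\<close>, which
  reaches \<open>7 + m\<close> because \<open>1 \<le> m\<close>; and moving the perturbation by
  \<open>\<tau>\<close> gains one order, since \<open>Q\<close> has order at least 2.\<close>

lemma Rk_equivalent_sextic_perturbation:
  fixes a :: complex and m :: nat
  defines "Z \<equiv> \<lambda>p. Complex (fst p) (snd p)"
  assumes "a \<noteq> 0" "1 \<le> m" and u: "vanishing_poly (Suc m) u" and v: "vanishing_poly (Suc m) v"
  shows "Rk_equivalent (6 + m) (\<lambda>p. Re (a * Z p ^ 6) + Re (Z p ^ 5 * Complex (u p) (v p)))
    (\<lambda>p. Re (a * Z p ^ 6))"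
proof -
  let ?h = "\<lambda>p. Re (a * Z p ^ 6)" and ?\<rho> = "\<lambda>p. Re (Z p ^ 5 * Complex (u p) (v p))"
  \<comment> \<open>Chosen so that the linear term \<open>6 * a * Z ^ 5 * Q\<close> cancels
    \<open>Z ^ 5 * Complex u v\<close>.\<close>
  define Q where "Q p = - 1 / (6 * a) * Complex (u p) (v p)" for p
  define \<tau> where "\<tau> p = (fst p + Re (Q p), snd p + Im (Q p))" for p
  \<comment> \<open>The cofactor of \<open>Q ^ 2\<close> in the binomial expansion of
    \<open>(Z + Q) ^ 6\<close>; it is homogeneous of degree 4 in \<open>Z\<close> and
    \<open>Q\<close>, so counting \<open>Q\<close> with order 1 suffices.\<close>
  define S where "S p = 15 * Z p ^ 4 + 20 * (Z p ^ 3 * Q p) + 15 * (Z p ^ 2 * Q p ^ 2)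
    + 6 * (Z p * Q p ^ 3) + Q p ^ 4" for p
  define R where "R p = Re (a * (Q p ^ 2 * S p)) + (?\<rho> (\<tau> p) - ?\<rho> p)" for p
  have Z: "vanishing_cpoly 1 Z"
    unfolding Z_def using vanishing_poly_fst vanishing_poly_snd by (rule vanishing_cpoly_Complex)
  have Q: "vanishing_cpoly (Suc m) Q"
    unfolding Q_def using u v by (intro vanishing_cpoly_cmult vanishing_cpoly_Complex)
  then have Q1: "vanishing_cpoly 1 Q" and Q2: "vanishing_cpoly 2 Q"
    using \<open>1 \<le> m\<close> by (auto elim: vanishing_cpoly_mono)
  have "vanishing_cpoly 4 S"
    unfolding S_def
    using vanishing_cpoly_power[OF Z, of 4] vanishing_cpoly_power[OF Q1, of 4]
      vanishing_cpoly_mult[OF vanishing_cpoly_power[OF Z, of 3] Q1]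
      vanishing_cpoly_mult[OF vanishing_cpoly_power[OF Z, of 2] vanishing_cpoly_power[OF Q1, of 2]]
      vanishing_cpoly_mult[OF Z vanishing_cpoly_power[OF Q1, of 3]]
    by (intro vanishing_cpoly_add vanishing_cpoly_cmult) simp_all
  from vanishing_cpoly_cmult[OF vanishing_cpoly_mult[OF vanishing_cpoly_power[OF Q, of 2] this]]
  have "vanishing_cpoly (Suc (6 + m)) (\<lambda>p. a * (Q p ^ 2 * S p))"
    using \<open>1 \<le> m\<close> by (rule_tac vanishing_cpoly_mono) auto
  moreover have "vanishing_cpoly (6 + m) (\<lambda>p. Z p ^ 5 * Complex (u p) (v p))"
    using vanishing_cpoly_mult[OF vanishing_cpoly_power[OF Z, of 5] vanishing_cpoly_Complex[OF u v]]
    by simp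
  then have "vanishing_poly (Suc (6 + m)) (\<lambda>p. ?\<rho> (\<tau> p) - ?\<rho> p)"
    using Q2 unfolding \<tau>_def vanishing_cpoly_def by (intro vanishing_poly_shift) simp_all
  ultimately have R: "vanishing_poly (Suc (6 + m)) R"
    unfolding R_def vanishing_cpoly_def by (intro vanishing_poly.add) simp_all
  have h: "vanishing_poly 6 ?h"
    using vanishing_cpoly_cmult[OF vanishing_cpoly_power[OF Z, of 6]]
    unfolding vanishing_cpoly_def by simp
  have sum_eq: "?h (\<tau> p) + ?\<rho> (\<tau> p) = ?h p + R p" for p
  proof -
    have "Z (\<tau> p) = Z p + Q p"
      by (simp add: Z_def \<tau>_def complex_eq_iff)
    moreover have "(Z p + Q p) ^ 6 = Z p ^ 6 + 6 * Q p * Z p ^ 5 + Q p ^ 2 * S p"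
      unfolding S_def by algebra
    moreover have "a * (6 * Q p * Z p ^ 5) = - (Z p ^ 5 * Complex (u p) (v p))"
      unfolding Q_def using \<open>a \<noteq> 0\<close> by (simp add: field_simps)
    ultimately have "a * Z (\<tau> p) ^ 6
        = a * Z p ^ 6 - Z p ^ 5 * Complex (u p) (v p) + a * (Q p ^ 2 * S p)"
      by (simp only: distrib_left) simp
    then show ?thesis
      unfolding R_def by simp
  qed
  have "diffeo_germ \<tau>"
    using Q2 unfolding \<tau>_def vanishing_cpoly_def by (intro diffeo_germ_id_plus_vanishing_poly) simp_all
  \<comment> \<open>The intermediate germ is the exact composite with \<open>\<tau>\<close>,
    rewritten by \<open>sum_eq\<close>; only its jet is compared with that of the sextic.\<close>
  then have "right_equivalent (\<lambda>p. ?h p + ?\<rho> p) (\<lambda>p. ?h p + R p)"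
    unfolding right_equivalent_def using sum_eq by (intro exI[of _ \<tau>]) simp
  moreover have "smooth_germ (\<lambda>p. ?h p + R p)"
    using h vanishing_poly_mono[OF R, of 6]
    by (intro smooth_germ_vanishing_poly[of 6] vanishing_poly.add) simp_all
  moreover have "jet (6 + m) (\<lambda>p. ?h p + R p) = jet (6 + m) ?h"
    by (rule jet_add_vanishing[OF h R])
  ultimately show ?thesis
    unfolding Rk_equivalent_def by blast
qed

theorem corollary2:
  fixes h6 :: "real \<times> real \<Rightarrow> real"
  assumes "homogeneous_poly 6 h6" and "harmonic h6" and "h6 \<noteq> (\<lambda>p. 0)"
  shows "(\<forall>\<rho>7. homogeneous_poly 7 \<rho>7 \<and> l_harmonic 3 \<rho>7 \<longrightarrow>
            Rk_equivalent 7 (\<lambda>p. h6 p + \<rho>7 p) h6) \<and>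
         (\<forall>\<rho>8. homogeneous_poly 8 \<rho>8 \<and> l_harmonic 4 \<rho>8 \<longrightarrow>
            Rk_equivalent 8 (\<lambda>p. h6 p + \<rho>8 p) h6)"
proof -
  obtain a where h6: "h6 = (\<lambda>p. Re (a * Complex (fst p) (snd p) ^ 6))"
    using harmonic_sextic[OF assms(1,2)] .
  with assms(3) have "a \<noteq> 0" by auto
  note normal_form = Rk_equivalent_sextic_perturbation[OF this]
  show ?thesis
  proof (intro conjI allI impI; elim conjE)
    fix \<rho>7 assume "homogeneous_poly 7 \<rho>7" "l_harmonic 3 \<rho>7"
    then obtain u v where "vanishing_poly 2 u" "vanishing_poly 2 v"
      and "\<rho>7 = (\<lambda>p. Re (Complex (fst p) (snd p) ^ 5 * Complex (u p) (v p)))"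
      by (rule triharmonic_septic)
    then show "Rk_equivalent 7 (\<lambda>p. h6 p + \<rho>7 p) h6"
      using normal_form[of 1 u v] by (simp add: h6 numeral_2_eq_2)
  next
    fix \<rho>8 assume "homogeneous_poly 8 \<rho>8" "l_harmonic 4 \<rho>8"
    then obtain u v where "vanishing_poly 3 u" "vanishing_poly 3 v"
      and "\<rho>8 = (\<lambda>p. Re (Complex (fst p) (snd p) ^ 5 * Complex (u p) (v p)))"
      by (rule tetraharmonic_octic)
    then show "Rk_equivalent 8 (\<lambda>p. h6 p + \<rho>8 p) h6"
      using normal_form[of 2 u v] by (simp add: h6)
  qed
qed

end
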